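(* Consider the group-sparse model $$\overline{\mathbf{y}}^P_{\mathbf{g}} = \ddot{\mathbf{B}}\,\mathbf{h}_{\mathbf{g}} + \overline{\mathbf{n}}^P_{\mathbf{g}},\qquad \ddot{\mathbf{B}}=\mathrm{blkdiag}(\mathbf{B}_1,\dots,\mathbf{B}_L)\in\mathbb{C}^{LN_z^P\times LL_h},$$ with $\mathbf{h}_{\mathbf{g}}=[\mathbf{h}_1^T,\dots,\mathbf{h}_L^T]^T$, $\mathbf{h}_l\in\mathbb{R}^{L_h\times 1}$, where $\mathbf{h}_{\mathbf{g}}$ is assigned the parameterized (real) Gaussian prior $$f(\mathbf{h}_{\mathbf{g}};\boldsymbol{\Gamma})=\prod_{l=1}^{L}\prod_{k=0}^{L_h-1}\frac{1}{(2\pi\gamma_k)^{1/2}}\exp\left(-\frac{|h_l(k)|^2}{2\gamma_k}\right),\qquad \boldsymbol{\Gamma}=\mathrm{diag}\{\gamma_k\}_{k=0}^{L_h-1},$$ and $\overline{\mathbf{n}}^P_{\mathbf{g}}\in\mathbb{C}^{LN_z^P\times 1}$ is zero-mean complex Gaussian noise with covariance matrix $\mathbf{R}_P$. Let $\widehat{\boldsymbol{\Gamma}}^{(j-1)}=\mathrm{diag}\{\widehat{\gamma}_k^{(j-1)}\}_{k=0}^{L_h-1}$ be the hyperparameter estimate in the $(j-1)$st iteration of the expectation-maximization (EM) algorithm. Then, in the $j$th EM iteration, the hyperparameter update $\widehat{\gamma}_k^{(j)}$, $0\le k\le L_h-1$, that maximizes, for the given $\widehat{\gamma}_k^{(j-1)}$,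 the conditional expectation of the log-likelihood function corresponding to the complete information set $\{\overline{\mathbf{y}}^P_{\mathbf{g}},\mathbf{h}_{\mathbf{g}}\}$, $$\mathcal{L}\left(\boldsymbol{\Gamma}\,|\,\widehat{\boldsymbol{\Gamma}}^{(j-1)}\right)=\mathbb{E}_{\mathbf{h}_{\mathbf{g}}\vert\overline{\mathbf{y}}^P_{\mathbf{g}};\,\widehat{\boldsymbol{\Gamma}}^{(j-1)}}\left\{\log\left[f\left(\overline{\mathbf{y}}^P_{\mathbf{g}},\mathbf{h}_{\mathbf{g}};\boldsymbol{\Gamma}\right)\right]\right\},$$ is $$\widehat{\gamma}_k^{(j)}=\frac1L\sum_{l=1}^{L}\boldsymbol{\Sigma}^{(j)}_{\mathbf{g}}\big[k+(l-1)L_h,\;k+(l-1)L_h\big]+\frac1L\sum_{l=1}^{L}\left|\boldsymbol{\mu}^{(j)}_{\mathbf{g}}\big[k+(l-1)L_h\big]\right|^2,$$ where $$\boldsymbol{\Sigma}^{(j)}_{\mathbf{g}}=\left[\ddot{\mathbf{B}}^H\mathbf{R}_P^{-1}\ddot{\mathbf{B}}+\mathbf{I}_L\otimes\left(\widehat{\boldsymbol{\Gamma}}^{(j-1)}\right)^{-1}\right]^{-1},\qquad \boldsymbol{\mu}^{(j)}_{\mathbf{g}}=\boldsymbol{\Sigma}^{(j)}_{\mathbf{g}}\ddot{\mathbf{B}}^H\mathbf{R}_P^{-1}\,\overline{\mathbf{y}}^P_{\mathbf{g}}.$$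
   Context: $L$, $L_h$, $N_z^P$ are positive integers (number of training frames, channel impulse response length, number of pilot observations per frame). The matrices $\mathbf{B}_1,\dots,\mathbf{B}_L\in\mathbb{C}^{N_z^P\times L_h}$ are known measurement matrices, $\overline{\mathbf{y}}^P_{\mathbf{g}}\in\mathbb{C}^{LN_z^P\times 1}$ is the received pilot vector, and $\mathbf{R}_P=\mathbb{E}[\overline{\mathbf{n}}^P_{\mathbf{g}}(\overline{\mathbf{n}}^P_{\mathbf{g}})^H]\in\mathbb{C}^{LN_z^P\times LN_z^P}$ is the known, invertible noise covariance matrix; the noise is independent of $\mathbf{h}_{\mathbf{g}}$. Vector and matrix entries are indexed from $0$, so the entry of $\mathbf{h}_{\mathbf{g}}$ with index $k+(l-1)L_h$ is $h_l(k)$, for $1\le l\le L$ and $0\le k\le L_h-1$. The entries $h_1(k),\dots,h_L(k)$ form the $k$th group and share the hyperparameter $\gamma_k>0$; the prior covariance of $\mathbf{h}_{\mathbf{g}}$ is $\mathbf{I}_L\otimes\boldsymbol{\Gamma}$. $f(\overline{\mathbf{y}}^P_{\mathbf{g}},\mathbf{h}_{\mathbf{g}};\boldsymbol{\Gamma})=f(\overline{\mathbf{y}}^P_{\mathbf{g}}\,|\,\mathbf{h}_{\mathbf{g}})\,f(\mathbf{h}_{\mathbf{g}};\boldsymbol{\Gamma})$ is the joint density of the complete data. The expectation $\mathbb{E}_{\mathbf{h}_{\mathbf{g}}|\overline{\mathbf{y}}^P_{\mathbf{g}};\widehat{\boldsymbol{\Gamma}}^{(j-1)}}$ is over the conditional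 (posterior) distribution of $\mathbf{h}_{\mathbf{g}}$ given $\overline{\mathbf{y}}^P_{\mathbf{g}}$ when the prior hyperparameter matrix equals $\widehat{\boldsymbol{\Gamma}}^{(j-1)}$. $(\cdot)^H$ is the conjugate transpose, $\otimes$ the Kronecker product, $\mathbf{I}_L$ the $L\times L$ identity matrix, and $\mathrm{blkdiag}$ a block-diagonal matrix.
   Formalization: The noise is additionally assumed to have pseudo-covariance C = E[n n^T] with B̈^H R_P^{-1} C = B̈^T; this excludes circularly symmetric noise (unless B̈ = 0), for which the stated update is false because h_g is real. *)

theory Defs
  imports "HOL-Probability.Probability"
begin

text \<open>
  A stacked vector of blocks of length \<open>n\<close> is indexed by pairs \<open>(l, i)\<close>; such a pair
  plays the role of the flat index \<open>i + (l - 1) n\<close>.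
\<close>

definition cvec :: "real^'i \<Rightarrow> complex^'i" where
  "cvec x = (\<chi> i. complex_of_real (x $ i))"

definition herm :: "complex^'j^'i \<Rightarrow> complex^'i^'j" where
  "herm A = (\<chi> i j. cnj (A $ j $ i))"

definition cdiag :: "real^'i \<Rightarrow> complex^'i^'i" where
  "cdiag d = (\<chi> i j. if i = j then complex_of_real (d $ i) else 0)"

definition blkdiag :: "('l::finite \<Rightarrow> complex^'k::finite^'n::finite) \<Rightarrow> complex^('l \<times> 'k)^('l \<times> 'n)" where
  "blkdiag B = (\<chi> p q. if fst p = fst q then B (fst p) $ snd p $ snd q else 0)"

definition kronecker :: "complex^'b::finite^'a::finite \<Rightarrow> complex^'d::finite^'c::finite \<Rightarrow> complex^('b \<times> 'd)^('a \<times> 'c)" where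
  "kronecker A C = (\<chi> p q. A $ fst p $ fst q * C $ snd p $ snd q)"


text \<open>
  Zero-mean complex Gaussian vectors. Every such vector (other than the constant \<open>0\<close>) has the law
  of \<open>V w\<close> with \<open>w\<close> real standard normal and \<open>V\<close> a complex matrix that is injective on real
  vectors; the real-linear span of its values is then the support of the law. The vector is
  circularly symmetric iff its pseudo-covariance \<open>E[n n\<^sup>T]\<close> vanishes, and the law is not determined
  by the covariance \<open>E[n n\<^sup>H]\<close> alone.
\<close>

definition std_normal_pdf :: "real^'m \<Rightarrow> real" where
  "std_normal_pdf w = (\<Prod>i\<in>UNIV. std_normal_density (w $ i))"

definition noise_map :: "complex^'m^'i \<Rightarrow> real^'m \<Rightarrow> complex^'i" where
  "noise_map V w = V *v cvec w"

definition noise_law :: "complex^'m^'i \<Rightarrow> (complex^'i) measure" where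
  "noise_law V = distr (density lborel (\<lambda>w. ennreal (std_normal_pdf w))) borel (noise_map V)"

definition noise_cov :: "complex^'m^'i \<Rightarrow> complex^'i^'i" where
  "noise_cov V = (\<chi> i j. \<integral>n. n $ i * cnj (n $ j) \<partial>noise_law V)"

definition noise_pseudo_cov :: "complex^'m^'i \<Rightarrow> complex^'i^'i" where
  "noise_pseudo_cov V = (\<chi> i j. \<integral>n. n $ i * n $ j \<partial>noise_law V)"

text \<open>
  For \<open>R = E[n n\<^sup>H]\<close> invertible and any complex matrix \<open>B\<close>, the identity
  \<open>B\<^sup>H R\<^sup>-\<^sup>1 E[n n\<^sup>T] = B\<^sup>T\<close> holds iff \<open>B\<^sup>H R\<^sup>-\<^sup>1 n\<close> is almost surely real. It is what makes
  \<open>\<Sigma> = (B\<^sup>H R\<^sup>-\<^sup>1 B + D\<^sup>-\<^sup>1)\<^sup>-\<^sup>1\<close> and \<open>\<Sigma> B\<^sup>H R\<^sup>-\<^sup>1 y\<close> the posterior covariance and mean of a real vector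
  \<open>h\<close> with prior covariance \<open>D\<close>, observed as \<open>y = B h + n\<close>. It fails for circularly symmetric
  noise unless \<open>B = 0\<close>.
\<close>

text \<open>
  The density of the noise with respect to Lebesgue measure transported to the support; see
  \<open>noise_law_eq_density\<close> below. Any other scaling of Lebesgue measure on the support multiplies this
  density by a constant.
\<close>

definition noise_pdf :: "complex^'m^'i \<Rightarrow> complex^'i \<Rightarrow> real" where
  "noise_pdf V n =
     (if n \<in> range (noise_map V) then std_normal_pdf (the_inv (noise_map V) n) else 0)"


definition prior_pdf :: "real^'k::finite \<Rightarrow> real^('l::finite \<times> 'k) \<Rightarrow> real" where
  "prior_pdf \<gamma> h = (\<Prod>l\<in>UNIV. \<Prod>k\<in>UNIV.
     1 / sqrt (2 * pi * \<gamma> $ k) * exp (- \<bar>h $ (l, k)\<bar>\<^sup>2 / (2 * \<gamma> $ k)))"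

definition likelihood ::
  "('l::finite \<Rightarrow> complex^'k::finite^'n::finite) \<Rightarrow> complex^'m^('l \<times> 'n) \<Rightarrow> complex^('l \<times> 'n) \<Rightarrow> real^('l \<times> 'k) \<Rightarrow> real" where
  "likelihood B V y h = noise_pdf V (y - blkdiag B *v cvec h)"

definition joint_pdf ::
  "('l::finite \<Rightarrow> complex^'k::finite^'n::finite) \<Rightarrow> complex^'m^('l \<times> 'n) \<Rightarrow> real^'k \<Rightarrow> complex^('l \<times> 'n) \<Rightarrow> real^('l \<times> 'k) \<Rightarrow> real"
  where "joint_pdf B V \<gamma> y h = likelihood B V y h * prior_pdf \<gamma> h"

definition posterior ::
  "('l::finite \<Rightarrow> complex^'k::finite^'n::finite) \<Rightarrow> complex^'m^('l \<times> 'n) \<Rightarrow> real^'k \<Rightarrow> complex^('l \<times> 'n)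
    \<Rightarrow> (real^('l \<times> 'k)) measure" where
  "posterior B V \<gamma> y = density lborel
     (\<lambda>h. ennreal (joint_pdf B V \<gamma> y h / (\<integral>h'. joint_pdf B V \<gamma> y h' \<partial>lborel)))"

definition em_objective ::
  "('l::finite \<Rightarrow> complex^'k::finite^'n::finite) \<Rightarrow> complex^'m^('l \<times> 'n) \<Rightarrow> complex^('l \<times> 'n) \<Rightarrow> real^'k \<Rightarrow> real^'k \<Rightarrow> real"
  where
  "em_objective B V y \<gamma>_prev \<gamma> = (\<integral>h. ln (joint_pdf B V \<gamma> y h) \<partial>posterior B V \<gamma>_prev y)"


definition Sigma_g ::
  "('l::finite \<Rightarrow> complex^'k::finite^'n::finite) \<Rightarrow> complex^('l \<times> 'n)^('l \<times> 'n) \<Rightarrow> real^'k \<Rightarrow> complex^('l \<times> 'k)^('l \<times> 'k)" where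
  "Sigma_g B R \<gamma> = matrix_inv
     (herm (blkdiag B) ** matrix_inv R ** blkdiag B + kronecker (mat 1) (matrix_inv (cdiag \<gamma>)))"

definition mu_g ::
  "('l::finite \<Rightarrow> complex^'k::finite^'n::finite) \<Rightarrow> complex^('l \<times> 'n)^('l \<times> 'n) \<Rightarrow> real^'k \<Rightarrow> complex^('l \<times> 'n)
    \<Rightarrow> complex^('l \<times> 'k)" where
  "mu_g B R \<gamma> y = (Sigma_g B R \<gamma> ** herm (blkdiag B) ** matrix_inv R) *v y"


lemma linear_noise_map: "linear (noise_map V)"
proof (rule linearI)
  fix x y :: "real^'a" and c :: real
  have "cvec (x + y) = cvec x + cvec y"
    by (simp add: cvec_def vec_eq_iff)
  then show "noise_map V (x + y) = noise_map V x + noise_map V y"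
    by (simp add: noise_map_def matrix_vector_right_distrib)
  have "(\<Sum>j\<in>UNIV. V $ i $ j * complex_of_real (c * x $ j)) =
      c *\<^sub>R (\<Sum>j\<in>UNIV. V $ i $ j * complex_of_real (x $ j))" for i
    unfolding scaleR_sum_right by (intro sum.cong refl) (simp add: scaleR_conv_of_real)
  then show "noise_map V (c *\<^sub>R x) = c *\<^sub>R noise_map V x"
    by (simp add: noise_map_def cvec_def matrix_vector_mult_def vec_eq_iff)
qed

lemma borel_measurable_std_normal_pdf: "std_normal_pdf \<in> borel_measurable borel"
  unfolding std_normal_pdf_def
  by (intro borel_measurable_prod measurable_compose[OF _ borel_measurable_normal_density]
      borel_measurable_continuous_onI continuous_intros)

lemma borel_measurable_noise_pdf:
  assumes inj: "inj (noise_map V)"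
  shows "noise_pdf V \<in> borel_measurable borel"
proof -
  obtain g where g: "linear g" "g \<circ> noise_map V = id"
    using linear_injective_left_inverse[OF linear_noise_map inj] by blast
  have eq: "noise_pdf V =
      (\<lambda>n. if n \<in> range (noise_map V) then std_normal_pdf (g n) else 0)"
  proof
    fix n
    have "the_inv (noise_map V) n = g n" if "n \<in> range (noise_map V)"
      using that g(2) inj by (auto simp: the_inv_f_f fun_eq_iff)
    then show "noise_pdf V n =
        (if n \<in> range (noise_map V) then std_normal_pdf (g n) else 0)"
      by (simp add: noise_pdf_def)
  qed
  have "closed (range (noise_map V))"
    by (intro closed_subspace linear_subspace_image linear_noise_map subspace_UNIV)
  moreover have "g \<in> borel_measurable borel"
    using g(1) by (intro borel_measurable_continuous_onI linear_continuous_on)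
      (simp add: linear_conv_bounded_linear)
  ultimately show ?thesis
    unfolding eq
    by (intro measurable_If_set measurable_const measurable_compose[OF _ borel_measurable_std_normal_pdf])
      simp_all
qed

lemma noise_law_eq_density:
  assumes "inj (noise_map V)"
  shows "noise_law V = density (distr lborel borel (noise_map V)) (\<lambda>n. ennreal (noise_pdf V n))"
proof -
  have "noise_map V \<in> borel_measurable borel"
    using linear_noise_map by (intro borel_measurable_continuous_onI linear_continuous_on)
      (simp add: linear_conv_bounded_linear)
  then have "density (distr lborel borel (noise_map V)) (\<lambda>n. ennreal (noise_pdf V n)) =
      distr (density lborel (\<lambda>w. ennreal (noise_pdf V (noise_map V w)))) borel (noise_map V)"
    using borel_measurable_noise_pdf[OF assms] by (intro density_distr) auto
  then show ?thesis
    by (simp add: noise_law_def noise_pdf_def the_inv_f_f[OF assms])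
qed

end

theory Submission
  imports Defs
begin

text \<open>
  Write \<open>R = V V\<^sup>H\<close> and \<open>A\<close> for the block-diagonal measurement matrix. The condition on the
  pseudo-covariance forces \<open>W = V\<^sup>H R\<^sup>-\<^sup>1 A\<close> to be real, and \<open>A = V W\<close>. So the observation is
  \<open>y = V z\<close> with \<open>z = W h + w\<close>, a real linear model with white noise; completing the square, its
  posterior is Gaussian with precision \<open>S = W\<^sup>T W + D\<^sup>-\<^sup>1\<close> and mean \<open>S\<^sup>-\<^sup>1 W\<^sup>T z\<close>, whose
  complex embeddings are \<open>\<Sigma>\<^sup>-\<^sup>1\<close> and \<open>\<mu>\<close>. Up to a constant, the objective is then
  \<open>- (L / 2) \<Sum>\<^sub>k (ln \<gamma>\<^sub>k + r\<^sub>k / \<gamma>\<^sub>k)\<close>, where \<open>r\<^sub>k\<close> is the average posterior second moment of the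
  \<open>k\<close>-th group, and each summand has its strict minimum at \<open>\<gamma>\<^sub>k = r\<^sub>k\<close>.
\<close>

section \<open>Moments of Gaussian weights\<close>

lemma integral_lborel_translate:
  fixes f :: "'a::euclidean_space \<Rightarrow> real"
  assumes "f \<in> borel_measurable borel"
  shows "(\<integral>x. f (x + a) \<partial>lborel) = (\<integral>x. f x \<partial>lborel)"
proof -
  have "(\<integral>x. f x \<partial>distr lborel borel ((+) a)) = (\<integral>x. f (a + x) \<partial>lborel)"
    using assms by (intro integral_distr) auto
  then show ?thesis by (simp add: lborel_distr_plus add.commute)
qed

lemma integrable_lborel_translate:
  fixes f :: "'a::euclidean_space \<Rightarrow> real"
  assumes "integrable lborel f"
  shows "integrable lborel (\<lambda>x. f (x + a))"
proof -
  have "integrable (distr lborel borel ((+) a)) f"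
    using assms by (simp add: lborel_distr_plus)
  then have "integrable lborel (\<lambda>x. f (a + x))"
    by (rule integrable_distr[rotated]) auto
  then show ?thesis by (simp add: add.commute)
qed

lemma integral_lborel_reflect:
  fixes f :: "'a::euclidean_space \<Rightarrow> real"
  assumes "f \<in> borel_measurable borel"
  shows "(\<integral>x. f (- x) \<partial>lborel) = (\<integral>x. f x \<partial>lborel)"
proof -
  have *: "distr lborel borel uminus = (lborel :: 'a measure)"
    by (subst lborel_affine[of "-1" 0]) (auto simp: density_1 one_ennreal_def[symmetric])
  have "(\<integral>x. f x \<partial>distr lborel borel uminus) = (\<integral>x. f (- x) \<partial>lborel)"
    using assms by (intro integral_distr) auto
  then show ?thesis by (simp add: *)
qed

lemma integrable_gaussian_real:
  assumes "0 < (c::real)"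
  shows "integrable lborel (\<lambda>x::real. exp (- c * x\<^sup>2))"
proof -
  \<comment> \<open>The standard deviation with \<open>1 / (2 * \<sigma>\<^sup>2) = c\<close>, so
    that the integrand is a multiple of a normal density.\<close>
  define \<sigma> where "\<sigma> = 1 / sqrt (2 * c)"
  have "2 * \<sigma>\<^sup>2 = 1 / c"
    using assms by (simp add: \<sigma>_def power_divide)
  then have "exp (- c * x\<^sup>2) = sqrt (2 * pi * \<sigma>\<^sup>2) * normal_density 0 \<sigma> x" for x
    using assms by (simp add: normal_density_def \<sigma>_def)
  then show ?thesis
    using assms by (simp add: \<sigma>_def)
qed

text \<open>The integrand is a product of one-dimensional Gaussians over the basis coordinates, so
  its integral factorises by Tonelli into finitely many finite factors.\<close>

lemma integrable_gaussian:
  assumes "0 < (c::real)"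
  shows "integrable lborel (\<lambda>x::'a::euclidean_space. exp (- c * (x \<bullet> x)))"
proof (rule integrableI_bounded)
  have "exp (- c * (x \<bullet> x)) = (\<Prod>b\<in>Basis. exp (- c * (x \<bullet> b)\<^sup>2))" for x :: 'a
    by (simp add: exp_sum[symmetric] euclidean_inner[of x x] sum_distrib_left power2_eq_square sum_negf)
  then have "(\<integral>\<^sup>+x. ennreal (norm (exp (- c * (x \<bullet> x)))) \<partial>(lborel :: 'a measure)) =
      (\<integral>\<^sup>+x. (\<Prod>b\<in>Basis. ennreal (exp (- c * (x \<bullet> b)\<^sup>2))) \<partial>(lborel :: 'a measure))"
    by (simp add: prod_ennreal prod_nonneg abs_of_nonneg del: exp_minus)
  also have "\<dots> = (\<Prod>b\<in>(Basis::'a set). \<integral>\<^sup>+x. ennreal (exp (- c * x\<^sup>2)) \<partial>lborel)"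
    by (rule nn_integral_lborel_prod) auto
  also have "\<dots> < \<infinity>"
    using integrable_gaussian_real[OF assms]
    by (simp add: nn_integral_eq_integral power_less_top_ennreal)
  finally show "(\<integral>\<^sup>+x. ennreal (norm (exp (- c * (x \<bullet> x)))) \<partial>(lborel :: 'a measure)) < \<infinity>" .
qed simp

section \<open>Hyperbolic inequalities for the squeeze argument\<close>

lemma sinh_ge_self: "0 \<le> x \<Longrightarrow> x \<le> sinh (x::real)"
proof -
  assume "0 \<le> x"
  have "sinh 0 - 0 \<le> sinh x - x"
    using \<open>0 \<le> x\<close>
    by (rule DERIV_nonneg_imp_nondecreasing)
      (auto intro!: exI derivative_eq_intros simp: cosh_real_ge_1)
  then show ?thesis by simp
qed

text \<open>The difference \<open>x * cosh x - sinh x\<close> vanishes at 0 and has derivative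
  \<open>x * sinh x\<close>, which is nonnegative for x \<ge> 0.\<close>

lemma sinh_le_self_mult_cosh: "0 \<le> x \<Longrightarrow> sinh (x::real) \<le> x * cosh x"
proof -
  assume "0 \<le> x"
  have "0 * cosh 0 - sinh 0 \<le> x * cosh x - sinh x"
    using \<open>0 \<le> x\<close>
    by (rule DERIV_nonneg_imp_nondecreasing)
      (auto intro!: exI derivative_eq_intros)
  then show ?thesis by simp
qed

text \<open>All three expressions are even in \<open>s\<close>, which reduces the claim to s \<ge>
  0. Divided by \<open>t\<close>, both bounds tend to \<open>s\<^sup>2\<close> as \<open>t\<close>
  tends to 0.\<close>

lemma mult_sinh_bounds:
  fixes s t :: real
  assumes "0 < t"
  shows "t * s\<^sup>2 \<le> s * sinh (t * s)" "s * sinh (t * s) \<le> t * s\<^sup>2 * cosh (t * s)"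
proof -
  have *: "t * s\<^sup>2 \<le> s * sinh (t * s) \<and> s * sinh (t * s) \<le> t * s\<^sup>2 * cosh (t * s)" if "0 \<le> s" for s
    using mult_left_mono[OF sinh_ge_self[of "t * s"] that]
      mult_left_mono[OF sinh_le_self_mult_cosh[of "t * s"] that] assms that
    by (simp add: power2_eq_square mult_ac)
  show "t * s\<^sup>2 \<le> s * sinh (t * s)" "s * sinh (t * s) \<le> t * s\<^sup>2 * cosh (t * s)"
    using *[of s] *[of "- s"] by (cases "0 \<le> s"; simp)+
qed

section \<open>Unnormalised Gaussian weights with precision operator \<open>S\<close>\<close>

locale gaussian_weight =
  fixes S :: "'a::euclidean_space \<Rightarrow> 'a" and c :: real
  assumes linear: "linear S"
    and symmetric: "x \<bullet> S y = S x \<bullet> y"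
    and coercive: "c * (x \<bullet> x) \<le> x \<bullet> S x" "0 < c"
begin

definition weight :: "'a \<Rightarrow> real" where
  "weight x = exp (- (x \<bullet> S x) / 2)"

abbreviation total :: real where
  "total \<equiv> (\<integral>x. weight x \<partial>lborel)"

lemma weight_pos: "0 < weight x"
  by (simp add: weight_def)

lemma measurable_form: "S \<in> borel_measurable borel"
  using linear by (intro borel_measurable_continuous_onI linear_continuous_on)
    (simp add: linear_conv_bounded_linear)

lemma measurable_weight [measurable]: "weight \<in> borel_measurable borel"
  unfolding weight_def using measurable_form by measurable

text \<open>Coercivity bounds the weight by the square of
  \<open>exp (- (c / 4) * (x \<bullet> x))\<close>. One factor absorbs the quadratic growth of
  \<open>f\<close>, the other one remains as an integrable majorant.\<close>

lemma integrable_mult_weight: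
  assumes [measurable]: "f \<in> borel_measurable borel"
    and bound: "\<And>x. \<bar>f x\<bar> \<le> a + b * (x \<bullet> x)"
  shows "integrable lborel (\<lambda>x. f x * weight x)"
proof (rule Bochner_Integration.integrable_bound)
  let ?g = "\<lambda>x::'a. (\<bar>a\<bar> + \<bar>b\<bar> * (4 / c)) * exp (- (c / 4) * (x \<bullet> x))"
  show "integrable lborel ?g"
    using coercive(2) by (intro integrable_mult_right integrable_gaussian) simp
  have "\<bar>f x\<bar> * weight x \<le> ?g x" for x
  proof -
    define e where "e = exp (- (c / 4) * (x \<bullet> x))"
    have e: "0 < e" "e \<le> 1"
      using coercive(2) by (auto simp: e_def)
    \<comment> \<open>With \<open>u = c / 4 * (x \<bullet> x)\<close>, the inequality
      \<open>u \<le> exp u\<close> bounds \<open>u * exp (- u)\<close> by 1, hence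
      \<open>(x \<bullet> x) * e\<close> by \<open>4 / c\<close>.\<close>
    have "c / 4 * (x \<bullet> x) \<le> exp (c / 4 * (x \<bullet> x))"
      using exp_ge_add_one_self[of "c / 4 * (x \<bullet> x)"] by linarith
    then have "c / 4 * (x \<bullet> x) * e \<le> exp (c / 4 * (x \<bullet> x)) * e"
      using e by (intro mult_right_mono) auto
    also have "\<dots> = 1"
      by (simp add: e_def exp_add[symmetric])
    finally have xe: "(x \<bullet> x) * e \<le> 4 / c"
      using coercive(2) by (simp add: field_simps)
    have "weight x \<le> exp (- c / 2 * (x \<bullet> x))"
      using coercive(1)[of x] by (simp add: weight_def)
    also have "\<dots> = e * e"
      by (simp add: e_def exp_add[symmetric])
    finally have "\<bar>f x\<bar> * weight x \<le> (\<bar>a\<bar> + \<bar>b\<bar> * (x \<bullet> x)) * (e * e)"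
    proof (intro mult_mono)
      have "b * (x \<bullet> x) \<le> \<bar>b\<bar> * (x \<bullet> x)"
        by (intro mult_right_mono) auto
      then show "\<bar>f x\<bar> \<le> \<bar>a\<bar> + \<bar>b\<bar> * (x \<bullet> x)"
        using bound[of x] by linarith
    qed (use weight_pos[of x] in auto)
    also have "\<dots> = (\<bar>a\<bar> * e + \<bar>b\<bar> * ((x \<bullet> x) * e)) * e"
      by (simp add: algebra_simps)
    also have "\<dots> \<le> (\<bar>a\<bar> * 1 + \<bar>b\<bar> * (4 / c)) * e"
      using e xe by (intro mult_right_mono add_mono mult_left_mono) auto
    finally show ?thesis by (simp add: e_def)
  qed
  then show "AE x in lborel. norm (f x * weight x) \<le> norm (?g x)"
    using coercive(2) weight_pos by (auto simp: abs_mult less_imp_le)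
qed measurable

lemma integrable_weight: "integrable lborel weight"
  using integrable_mult_weight[of "\<lambda>_. 1" 1 0] by simp

lemma total_pos: "0 < total"
proof -
  have "total \<noteq> 0"
  proof
    assume "total = 0"
    then have "AE x in lborel. weight x = 0"
      using integral_nonneg_eq_0_iff_AE[OF integrable_weight] weight_pos by (simp add: less_imp_le)
    \<comment> \<open>A strictly positive weight with integral zero would make the whole space a
      null set.\<close>
    then have "AE x in (lborel :: 'a measure). False"
      using weight_pos by (auto simp: less_le elim: eventually_mono)
    then show False by (simp add: trivial_limit_def[symmetric] ae_filter_eq_bot_iff)
  qed
  moreover have "0 \<le> total"
    using weight_pos by (intro integral_nonneg_AE) (auto simp: less_imp_le)
  ultimately show ?thesis by simp
qed

lemma abs_inner_le: "\<bar>x \<bullet> a\<bar> \<le> 1 + (a \<bullet> a) * (x \<bullet> x)"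
proof -
  have "\<bar>x \<bullet> a\<bar>\<^sup>2 \<le> (a \<bullet> a) * (x \<bullet> x)"
    using Cauchy_Schwarz_ineq[of x a] by (simp add: mult.commute)
  moreover have "2 * \<bar>x \<bullet> a\<bar> \<le> 1 + \<bar>x \<bullet> a\<bar>\<^sup>2"
    using sum_squares_ge_zero[of "\<bar>x \<bullet> a\<bar> - 1" 0] by (simp add: power2_eq_square algebra_simps)
  ultimately show ?thesis
    using abs_ge_zero[of "x \<bullet> a"] by linarith
qed

lemma abs_inner_mult_le: "\<bar>(x \<bullet> a) * (x \<bullet> b)\<bar> \<le> 0 + (norm a * norm b) * (x \<bullet> x)"
proof -
  have "\<bar>x \<bullet> a\<bar> * \<bar>x \<bullet> b\<bar> \<le> (norm x * norm a) * (norm x * norm b)"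
    by (intro mult_mono Cauchy_Schwarz_ineq2) auto
  then show ?thesis by (simp add: abs_mult dot_square_norm power2_eq_square mult_ac)
qed

lemma integrable_inner_weight: "integrable lborel (\<lambda>x. (x \<bullet> a) * weight x)"
  by (rule integrable_mult_weight[OF _ abs_inner_le]) measurable

lemma integrable_inner_mult_weight: "integrable lborel (\<lambda>x. (x \<bullet> a) * (x \<bullet> b) * weight x)"
  by (rule integrable_mult_weight[OF _ abs_inner_mult_le]) measurable

text \<open>The weight is even and the inner product is odd, so reflection turns the integral into
  its negative.\<close>

lemma first_moment: "(\<integral>x. (x \<bullet> a) * weight x \<partial>lborel) = 0"
proof -
  have "(\<integral>x. (- x \<bullet> a) * weight (- x) \<partial>lborel) = (\<integral>x. (x \<bullet> a) * weight x \<partial>lborel)"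
    by (rule integral_lborel_reflect[of "\<lambda>x. (x \<bullet> a) * weight x"]) measurable
  then show ?thesis
    by (simp add: weight_def linear_neg[OF linear])
qed

text \<open>
  Since translating by \<open>t v\<close> multiplies the weight by \<open>exp (- t s - t\<^sup>2 q / 2)\<close> with \<open>s = x \<bullet> S v\<close>
  and \<open>q = v \<bullet> S v\<close>, the translation invariance of \<open>lborel\<close> evaluates the integrals of
  \<open>s sinh (t s)\<close> and \<open>s\<^sup>2 cosh (t s)\<close>. These squeeze the integral of \<open>s\<^sup>2\<close> as \<open>t\<close> tends to 0.
\<close>

lemma weight_translate:
  "weight (x + t *\<^sub>R v) = weight x * exp (- t * (x \<bullet> S v)) * exp (- t\<^sup>2 * (v \<bullet> S v) / 2)"
proof -
  have "v \<bullet> S x = x \<bullet> S v"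
    using symmetric[of v x] by (simp add: inner_commute)
  then have "(x + t *\<^sub>R v) \<bullet> S (x + t *\<^sub>R v) = x \<bullet> S x + 2 * t * (x \<bullet> S v) + t\<^sup>2 * (v \<bullet> S v)"
    by (simp add: linear_add[OF linear] linear_cmul[OF linear] inner_add_left inner_add_right
        power2_eq_square algebra_simps)
  then show ?thesis
    by (simp add: weight_def exp_add[symmetric] field_simps)
qed

text \<open>The exponential tilt is absorbed by moving the centre of the weight: substituting
  \<open>x + t *\<^sub>R v\<close> raises \<open>x \<bullet> S v\<close> by
  \<open>t * (v \<bullet> S v)\<close>, which the shifted argument of \<open>F\<close> compensates.
  It is applied with \<open>F\<close> the identity and the square.\<close>

lemma exponential_moment:
  assumes [measurable]: "F \<in> borel_measurable borel"
    and int: "integrable lborel (\<lambda>x. F (x \<bullet> S v - t * (v \<bullet> S v)) * weight x)"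
  shows "integrable lborel (\<lambda>x. F (x \<bullet> S v) * exp (- t * (x \<bullet> S v)) * weight x)"
    and "(\<integral>x. F (x \<bullet> S v) * exp (- t * (x \<bullet> S v)) * weight x \<partial>lborel) =
      exp (t\<^sup>2 * (v \<bullet> S v) / 2) * (\<integral>x. F (x \<bullet> S v - t * (v \<bullet> S v)) * weight x \<partial>lborel)"
proof -
  let ?G = "\<lambda>x. F (x \<bullet> S v - t * (v \<bullet> S v)) * weight x"
  have eq: "F (x \<bullet> S v) * exp (- t * (x \<bullet> S v)) * weight x =
      exp (t\<^sup>2 * (v \<bullet> S v) / 2) * ?G (x + t *\<^sub>R v)" for x
    by (simp add: weight_translate inner_add_left exp_minus field_simps)
  show "integrable lborel (\<lambda>x. F (x \<bullet> S v) * exp (- t * (x \<bullet> S v)) * weight x)"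
    unfolding eq by (intro integrable_mult_right integrable_lborel_translate[OF int])
  show "(\<integral>x. F (x \<bullet> S v) * exp (- t * (x \<bullet> S v)) * weight x \<partial>lborel) =
      exp (t\<^sup>2 * (v \<bullet> S v) / 2) * (\<integral>x. ?G x \<partial>lborel)"
    unfolding eq by (subst integral_mult_right_zero, subst integral_lborel_translate) auto
qed

lemma second_moment_diagonal:
  "(\<integral>x. (x \<bullet> S v)\<^sup>2 * weight x \<partial>lborel) = (v \<bullet> S v) * total" (is "?m = ?q * _")
proof -
  let ?s = "\<lambda>x. x \<bullet> S v"
  have int0: "integrable lborel weight" "integrable lborel (\<lambda>x. ?s x * weight x)"
      "integrable lborel (\<lambda>x. (?s x)\<^sup>2 * weight x)"
    using integrable_weight integrable_inner_weight integrable_inner_mult_weight[of "S v" "S v"]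
    by (auto simp: power2_eq_square)
  have e1: "(?s x - t * ?q) * weight x = ?s x * weight x - t * ?q * weight x" for x t
    by (simp add: algebra_simps)
  have e2: "(?s x - t * ?q)\<^sup>2 * weight x =
      (?s x)\<^sup>2 * weight x - 2 * t * ?q * (?s x * weight x) + t\<^sup>2 * ?q\<^sup>2 * weight x" for x t
    by (simp add: power2_eq_square algebra_simps)
  have i1: "integrable lborel (\<lambda>x. ?s x * exp (- t * ?s x) * weight x)"
    and v1: "(\<integral>x. ?s x * exp (- t * ?s x) * weight x \<partial>lborel) = - (exp (t\<^sup>2 * ?q / 2) * (t * ?q * total))" for t
    using exponential_moment[of "\<lambda>u. u" v t] int0 first_moment[of "S v"] by (simp_all add: e1)
  have i2: "integrable lborel (\<lambda>x. (?s x)\<^sup>2 * exp (- t * ?s x) * weight x)"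
    and v2: "(\<integral>x. (?s x)\<^sup>2 * exp (- t * ?s x) * weight x \<partial>lborel) =
      exp (t\<^sup>2 * ?q / 2) * (?m + t\<^sup>2 * ?q\<^sup>2 * total)" for t
    using exponential_moment[of "\<lambda>u. u\<^sup>2" v t] int0 first_moment[of "S v"] by (simp_all add: e2)
  \<comment> \<open>Both hyperbolic functions are half sums or differences of the tilts with
    parameters \<open>- t\<close> and \<open>t\<close>, so their integrals follow from
    \<open>v1\<close> and \<open>v2\<close>.\<close>
  have si: "?s x * sinh (t * ?s x) * weight x =
      (?s x * exp (- (- t) * ?s x) * weight x - ?s x * exp (- t * ?s x) * weight x) / 2" for x t
    by (simp add: sinh_def algebra_simps diff_divide_distrib)
  have ci: "(?s x)\<^sup>2 * cosh (t * ?s x) * weight x =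
      ((?s x)\<^sup>2 * exp (- (- t) * ?s x) * weight x + (?s x)\<^sup>2 * exp (- t * ?s x) * weight x) / 2" for x t
    by (simp add: cosh_def algebra_simps add_divide_distrib)
  have int_sinh: "integrable lborel (\<lambda>x. ?s x * sinh (t * ?s x) * weight x)" for t
    unfolding si by (intro integrable_divide Bochner_Integration.integrable_diff i1)
  have int_cosh: "integrable lborel (\<lambda>x. (?s x)\<^sup>2 * cosh (t * ?s x) * weight x)" for t
    unfolding ci by (intro integrable_divide Bochner_Integration.integrable_add i2)
  have val_sinh: "(\<integral>x. ?s x * sinh (t * ?s x) * weight x \<partial>lborel) = t * (?q * total * exp (t\<^sup>2 * ?q / 2))" for t
    unfolding si using i1[of t] i1[of "-t"] v1[of t] v1[of "-t"] by simp
  have val_cosh: "(\<integral>x. (?s x)\<^sup>2 * cosh (t * ?s x) * weight x \<partial>lborel) =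
      exp (t\<^sup>2 * ?q / 2) * (?m + t\<^sup>2 * ?q\<^sup>2 * total)" for t
    unfolding ci using i2[of t] i2[of "-t"] v2[of t] v2[of "-t"] by simp
  \<comment> \<open>Integrating the lower bound for \<open>s * sinh (t * s)\<close> and dividing by
    \<open>t\<close> bounds the second moment from above.\<close>
  have upper: "?m \<le> ?q * total * exp (t\<^sup>2 * ?q / 2)" if "0 < t" for t
  proof -
    have "(\<integral>x. t * ((?s x)\<^sup>2 * weight x) \<partial>lborel) \<le> (\<integral>x. ?s x * sinh (t * ?s x) * weight x \<partial>lborel)"
      using mult_right_mono[OF mult_sinh_bounds(1)[OF that] less_imp_le[OF weight_pos]]
      by (intro integral_mono integrable_mult_right int0 int_sinh) (simp add: mult.assoc)
    then show ?thesis using that by (simp add: val_sinh)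
  qed
  \<comment> \<open>Integrating the upper bound for \<open>s * sinh (t * s)\<close> leaves the same
    exponential factor on both sides, and it cancels.\<close>
  have lower: "?q * total \<le> ?m + t\<^sup>2 * ?q\<^sup>2 * total" if "0 < t" for t
  proof -
    have "(\<integral>x. ?s x * sinh (t * ?s x) * weight x \<partial>lborel) \<le>
        (\<integral>x. t * ((?s x)\<^sup>2 * cosh (t * ?s x) * weight x) \<partial>lborel)"
      using mult_right_mono[OF mult_sinh_bounds(2)[OF that] less_imp_le[OF weight_pos]]
      by (intro integral_mono integrable_mult_right int_sinh int_cosh) (simp add: mult.assoc)
    then have "t * (?q * total * exp (t\<^sup>2 * ?q / 2)) \<le> t * (exp (t\<^sup>2 * ?q / 2) * (?m + t\<^sup>2 * ?q\<^sup>2 * total))"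
      by (simp add: val_sinh val_cosh)
    then have "exp (t\<^sup>2 * ?q / 2) * (?q * total) \<le> exp (t\<^sup>2 * ?q / 2) * (?m + t\<^sup>2 * ?q\<^sup>2 * total)"
      using that by (simp add: mult_ac)
    then show ?thesis by simp
  qed
  have ev: "eventually (\<lambda>t. 0 < t) (at_right (0::real))"
    by (rule eventually_at_right_less)
  have "?m \<le> ?q * total"
  proof (rule tendsto_lowerbound)
    show "((\<lambda>t. ?q * total * exp (t\<^sup>2 * ?q / 2)) \<longlongrightarrow> ?q * total) (at_right 0)"
      by (auto intro!: tendsto_eq_intros)
    show "\<forall>\<^sub>F t in at_right 0. ?m \<le> ?q * total * exp (t\<^sup>2 * ?q / 2)"
      using ev by eventually_elim (rule upper)
  qed simp
  moreover have "?q * total \<le> ?m"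
  proof (rule tendsto_lowerbound)
    show "((\<lambda>t. ?m + t\<^sup>2 * ?q\<^sup>2 * total) \<longlongrightarrow> ?m) (at_right 0)"
      by (auto intro!: tendsto_eq_intros)
    show "\<forall>\<^sub>F t in at_right 0. ?q * total \<le> ?m + t\<^sup>2 * ?q\<^sup>2 * total"
      using ev by eventually_elim (rule lower)
  qed simp
  ultimately show ?thesis by simp
qed

text \<open>Polarisation of the diagonal case. Testing against \<open>S u\<close> and
  \<open>S v\<close> expresses that the covariance is the inverse of \<open>S\<close> without
  writing an inverse.\<close>

lemma second_moment:
  "(\<integral>x. (x \<bullet> S u) * (x \<bullet> S v) * weight x \<partial>lborel) = (u \<bullet> S v) * total"
proof -
  have "(x \<bullet> S u) * (x \<bullet> S v) * weight x =
      ((x \<bullet> S (u + v))\<^sup>2 * weight x - (x \<bullet> S u)\<^sup>2 * weight x - (x \<bullet> S v)\<^sup>2 * weight x) / 2" for x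
    by (simp add: linear_add[OF linear] inner_add_right power2_eq_square algebra_simps)
  moreover have "integrable lborel (\<lambda>x. (x \<bullet> S w)\<^sup>2 * weight x)" for w
    using integrable_inner_mult_weight[of "S w" "S w"] by (simp add: power2_eq_square)
  ultimately have "(\<integral>x. (x \<bullet> S u) * (x \<bullet> S v) * weight x \<partial>lborel) =
      ((\<integral>x. (x \<bullet> S (u + v))\<^sup>2 * weight x \<partial>lborel) - (\<integral>x. (x \<bullet> S u)\<^sup>2 * weight x \<partial>lborel) -
        (\<integral>x. (x \<bullet> S v)\<^sup>2 * weight x \<partial>lborel)) / 2"
    by (simp only: integral_divide_zero Bochner_Integration.integral_diff Bochner_Integration.integrable_diff)
  also have "\<dots> = ((u + v) \<bullet> S (u + v) - u \<bullet> S u - v \<bullet> S v) * total / 2"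
    unfolding second_moment_diagonal by (simp add: left_diff_distrib)
  also have "(u + v) \<bullet> S (u + v) - u \<bullet> S u - v \<bullet> S v = 2 * (u \<bullet> S v)"
    using symmetric[of v u] by (simp add: linear_add[OF linear] inner_add_left inner_add_right inner_commute)
  finally show ?thesis by simp
qed

section \<open>Normalised Gaussian measures and their moments\<close>

definition gaussian :: "'a \<Rightarrow> 'a measure" where
  "gaussian \<mu> = density lborel (\<lambda>x. ennreal (weight (x - \<mu>) / total))"

lemma integrable_gaussian_iff:
  assumes [measurable]: "f \<in> borel_measurable borel"
  shows "integrable (gaussian \<mu>) f \<longleftrightarrow> integrable lborel (\<lambda>x. f (x + \<mu>) * weight x :: real)"
proof -
  have "integrable (gaussian \<mu>) f \<longleftrightarrow> integrable lborel (\<lambda>x. weight (x - \<mu>) / total * f x)"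
    unfolding gaussian_def using total_pos weight_pos
    by (subst integrable_density) (auto simp: less_imp_le)
  also have "\<dots> \<longleftrightarrow> integrable lborel (\<lambda>x. f x * weight (x - \<mu>))"
    using total_pos integrable_mult_left_iff[where M=lborel and c="1 / total" and f="\<lambda>x. f x * weight (x - \<mu>)"]
    by (simp add: mult.commute)
  also have "\<dots> \<longleftrightarrow> integrable lborel (\<lambda>x. f (x + \<mu>) * weight x)"
    using integrable_lborel_translate[of "\<lambda>x. f x * weight (x - \<mu>)" \<mu>]
      integrable_lborel_translate[of "\<lambda>x. f (x + \<mu>) * weight x" "- \<mu>"] by auto
  finally show ?thesis .
qed

lemma integral_gaussian:
  assumes [measurable]: "f \<in> borel_measurable borel"
  shows "(\<integral>x. f x \<partial>gaussian \<mu>) = (\<integral>x. f (x + \<mu>) * weight x \<partial>lborel) / total"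
proof -
  have "(\<integral>x. f x \<partial>gaussian \<mu>) = (\<integral>x. weight (x - \<mu>) / total * f x \<partial>lborel)"
    unfolding gaussian_def using total_pos weight_pos
    by (subst integral_density) (auto simp: less_imp_le)
  also have "\<dots> = (\<integral>x. f x * weight (x - \<mu>) \<partial>lborel) / total"
    by (simp add: mult.commute)
  also have "(\<integral>x. f x * weight (x - \<mu>) \<partial>lborel) = (\<integral>x. f (x + \<mu>) * weight x \<partial>lborel)"
    using integral_lborel_translate[of "\<lambda>x. f x * weight (x - \<mu>)" \<mu>] by simp
  finally show ?thesis .
qed

text \<open>Quadratic growth survives the shift by \<open>\<mu>\<close>, because the squared norm of
  a sum is at most twice the sum of the squared norms.\<close>

lemma integrable_gaussian_quadratic:
  assumes [measurable]: "f \<in> borel_measurable borel"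
    and bound: "\<And>x. \<bar>f x\<bar> \<le> a + b * (x \<bullet> x)" and "0 \<le> b"
  shows "integrable (gaussian \<mu>) f"
proof -
  have "\<bar>f (x + \<mu>)\<bar> \<le> (a + 2 * b * (\<mu> \<bullet> \<mu>)) + 2 * b * (x \<bullet> x)" for x
  proof -
    have "(x + \<mu>) \<bullet> (x + \<mu>) \<le> 2 * (x \<bullet> x) + 2 * (\<mu> \<bullet> \<mu>)"
      using inner_ge_zero[of "x - \<mu>"] by (simp add: algebra_simps inner_commute)
    then have "b * ((x + \<mu>) \<bullet> (x + \<mu>)) \<le> b * (2 * (x \<bullet> x) + 2 * (\<mu> \<bullet> \<mu>))"
      using \<open>0 \<le> b\<close> by (rule mult_left_mono)
    then show ?thesis
      using bound[of "x + \<mu>"] by (simp add: algebra_simps)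
  qed
  then show ?thesis
    by (subst integrable_gaussian_iff) (auto intro!: integrable_mult_weight)
qed

lemma integral_gaussian_const: "(\<integral>x. k \<partial>gaussian \<mu>) = (k :: real)"
  using total_pos by (subst integral_gaussian) simp_all

lemma integral_gaussian_mult_centered:
  "(\<integral>x. (x \<bullet> S u) * (x \<bullet> S v) \<partial>gaussian 0) = u \<bullet> S v"
  using total_pos by (simp add: integral_gaussian second_moment)

lemma integral_gaussian_power2:
  "(\<integral>x. (x \<bullet> S v)\<^sup>2 \<partial>gaussian \<mu>) = v \<bullet> S v + (\<mu> \<bullet> S v)\<^sup>2"
proof -
  have "((x + \<mu>) \<bullet> S v)\<^sup>2 * weight x =
      (x \<bullet> S v) * (x \<bullet> S v) * weight x + 2 * (\<mu> \<bullet> S v) * ((x \<bullet> S v) * weight x) + (\<mu> \<bullet> S v)\<^sup>2 * weight x" for x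
    by (simp add: inner_add_left power2_eq_square algebra_simps)
  then have "(\<integral>x. ((x + \<mu>) \<bullet> S v)\<^sup>2 * weight x \<partial>lborel) = (v \<bullet> S v) * total + (\<mu> \<bullet> S v)\<^sup>2 * total"
    using integrable_inner_mult_weight[of "S v" "S v"] integrable_inner_weight[of "S v"] integrable_weight
    by (simp add: second_moment first_moment)
  then show ?thesis
    using total_pos by (subst integral_gaussian) (simp_all add: field_simps)
qed

text \<open>The factor \<open>k\<close> cancels against the normalising integral, so a density known
  up to a positive constant already determines the measure.\<close>

lemma density_eq_gaussian:
  assumes "\<And>x. f x = k * weight (x - \<mu>)" "0 < k"
  shows "density lborel (\<lambda>x. ennreal (f x / (\<integral>x. f x \<partial>lborel))) = gaussian \<mu>"
proof -
  have "(\<integral>x. f x \<partial>lborel) = k * total"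
    using integral_lborel_translate[of weight "- \<mu>"] by (simp add: assms(1))
  then show ?thesis
    using \<open>0 < k\<close> by (simp add: gaussian_def assms(1))
qed

end

section \<open>Second moments of the noise\<close>

interpretation std: gaussian_weight "\<lambda>x :: 'a::euclidean_space. x" 1
  by standard (auto intro: linear_ident)

lemma prod_Basis_vec: "(\<Prod>b\<in>Basis. f (x \<bullet> b)) = (\<Prod>i\<in>UNIV. f ((x :: real^'i) $ i))"
proof -
  have basis: "(Basis :: (real^'i) set) = range (\<lambda>i. axis i 1)"
    by (auto simp: Basis_vec_def)
  have inj: "inj (\<lambda>i::'i. axis i (1::real))"
    by (auto simp: inj_on_def axis_eq_axis)
  show ?thesis
    unfolding basis by (subst prod.reindex[OF inj]) (simp add: inner_axis)
qed

lemma std_normal_pdf_eq: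
  "std_normal_pdf (w :: real^'m) = (1 / sqrt (2 * pi)) ^ CARD('m) * exp (- (w \<bullet> w) / 2)"
proof -
  have "std_normal_pdf w = (\<Prod>i\<in>(UNIV :: 'm set). 1 / sqrt (2 * pi) * exp (- (w $ i)\<^sup>2 / 2))"
    by (simp add: std_normal_pdf_def std_normal_density_def)
  also have "\<dots> = (1 / sqrt (2 * pi)) ^ CARD('m) * exp (\<Sum>i\<in>UNIV. - (w $ i)\<^sup>2 / 2)"
    by (simp add: prod.distrib exp_sum power_one_over prod_dividef)
  also have "(\<Sum>i\<in>UNIV. - (w $ i)\<^sup>2 / 2) = - (w \<bullet> w) / 2"
    by (simp add: inner_vec_def power2_eq_square sum_negf sum_divide_distrib)
  finally show ?thesis .
qed

lemma std_normal_pdf_pos: "0 < std_normal_pdf (w :: real^'m)"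
  by (simp add: std_normal_pdf_eq)

text \<open>By Tonelli the integral is a product of one-dimensional normal integrals. With total
  mass 1, the normalisation in \<open>std.density_eq_gaussian\<close> changes nothing.\<close>

lemma integral_std_normal_pdf: "(\<integral>w. std_normal_pdf (w :: real^'m) \<partial>lborel) = 1"
proof -
  have "(\<integral>\<^sup>+w. ennreal (std_normal_pdf w) \<partial>(lborel :: (real^'m) measure)) =
      (\<integral>\<^sup>+w. (\<Prod>b\<in>Basis. ennreal (std_normal_density (w \<bullet> b))) \<partial>(lborel :: (real^'m) measure))"
    by (simp add: prod_Basis_vec[of "\<lambda>x. ennreal (std_normal_density x)"] std_normal_pdf_def prod_ennreal)
  also have "\<dots> = (\<Prod>b\<in>(Basis :: (real^'m) set). \<integral>\<^sup>+x. ennreal (std_normal_density x) \<partial>lborel)"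
    by (rule nn_integral_lborel_prod) auto
  also have "\<dots> = 1"
    by (simp add: nn_integral_eq_integral)
  finally have "(\<integral>\<^sup>+w. ennreal (std_normal_pdf w) \<partial>(lborel :: (real^'m) measure)) = 1" .
  moreover have "(\<integral>w. std_normal_pdf w \<partial>(lborel :: (real^'m) measure)) =
      enn2real (\<integral>\<^sup>+w. ennreal (std_normal_pdf w) \<partial>(lborel :: (real^'m) measure))"
    by (rule integral_eq_nn_integral)
      (simp_all add: borel_measurable_std_normal_pdf order_less_imp_le[OF std_normal_pdf_pos])
  ultimately show ?thesis by simp
qed

lemma density_std_normal_pdf:
  "density lborel (\<lambda>w. ennreal (std_normal_pdf (w :: real^'m))) = std.gaussian 0"
proof -
  have "density lborel (\<lambda>w. ennreal (std_normal_pdf w / (\<integral>w. std_normal_pdf (w :: real^'m) \<partial>lborel))) =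
      (std.gaussian 0 :: (real^'m) measure)"
    by (rule std.density_eq_gaussian[where k = "(1 / sqrt (2 * pi)) ^ CARD('m)"])
      (simp_all add: std_normal_pdf_eq std.weight_def)
  then show ?thesis by (simp add: integral_std_normal_pdf)
qed

lemma std_gaussian_coordinates:
  "(\<integral>w. (w :: real^'m) $ a * w $ b \<partial>std.gaussian 0) = (if a = b then 1 else 0)"
  "integrable (std.gaussian 0) (\<lambda>w. (w :: real^'m) $ a * w $ b)"
proof -
  have ab: "w $ a * w $ b = (w \<bullet> axis a 1) * (w \<bullet> axis b 1)" for w :: "real^'m"
    by (simp add: inner_axis)
  show "(\<integral>w. (w :: real^'m) $ a * w $ b \<partial>std.gaussian 0) = (if a = b then 1 else 0)"
    unfolding ab std.integral_gaussian_mult_centered by (auto simp: inner_axis_axis)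
  show "integrable (std.gaussian 0) (\<lambda>w. (w :: real^'m) $ a * w $ b)"
    unfolding ab by (rule std.integrable_gaussian_quadratic[OF _ std.abs_inner_mult_le]) auto
qed

text \<open>The coordinates are orthonormal in mean square, so only the diagonal terms survive.
  Entries of the covariance and of the pseudo-covariance of the noise both have this bilinear
  form.\<close>

lemma integral_bilinear_std_gaussian:
  fixes M :: "'m::finite \<Rightarrow> 'm \<Rightarrow> complex"
  shows "(\<integral>w. (\<Sum>a\<in>UNIV. \<Sum>b\<in>UNIV. M a b * complex_of_real (w $ a * w $ b)) \<partial>std.gaussian 0) =
    (\<Sum>a\<in>UNIV. M a a)"
proof -
  have int: "integrable (std.gaussian 0) (\<lambda>w. M a b * complex_of_real (w $ a * w $ b))" for a b
    by (intro integrable_mult_right integrable_of_real std_gaussian_coordinates(2))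
  have val: "(\<integral>w. M a b * complex_of_real (w $ a * w $ b) \<partial>std.gaussian 0) = (if a = b then M a a else 0)" for a b
    by (subst integral_mult_right_zero, subst integral_complex_of_real)
      (simp add: std_gaussian_coordinates(1))
  show ?thesis
    by (subst Bochner_Integration.integral_sum, (intro Bochner_Integration.integrable_sum int),
        subst Bochner_Integration.integral_sum, (intro int), unfold val) simp
qed

section \<open>Covariance and pseudo-covariance as matrix products\<close>

lemma measurable_noise_map: "noise_map V \<in> borel_measurable borel"
  using linear_noise_map by (intro borel_measurable_continuous_onI linear_continuous_on)
    (simp add: linear_conv_bounded_linear)

lemma integral_noise_law:
  fixes f :: "complex^'i \<Rightarrow> complex"
  assumes "f \<in> borel_measurable borel"
  shows "(\<integral>n. f n \<partial>noise_law V) = (\<integral>w. f (noise_map V w) \<partial>std.gaussian 0)"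
proof -
  have "noise_map V \<in> measurable (std.gaussian 0) borel"
    using measurable_noise_map[of V] by (simp add: std.gaussian_def)
  then show ?thesis
    unfolding noise_law_def density_std_normal_pdf using assms by (rule integral_distr)
qed

lemma noise_cov_eq: "noise_cov (V :: complex^'m^'i) = V ** herm V"
proof -
  have "noise_cov V $ i $ j = (V ** herm V) $ i $ j" for i j
  proof -
    have "(\<lambda>n :: complex^'i. n $ i * cnj (n $ j)) \<in> borel_measurable borel"
      by (intro borel_measurable_continuous_onI continuous_intros)
    then have "noise_cov V $ i $ j = (\<integral>w. noise_map V w $ i * cnj (noise_map V w $ j) \<partial>std.gaussian 0)"
      by (simp add: noise_cov_def integral_noise_law)
    also have "\<dots> = (\<integral>w. (\<Sum>a\<in>UNIV. \<Sum>b\<in>UNIV. (V $ i $ a * cnj (V $ j $ b)) *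
        complex_of_real (w $ a * w $ b)) \<partial>std.gaussian 0)"
      by (simp add: noise_map_def matrix_vector_mult_def cvec_def sum_product mult_ac)
    also have "\<dots> = (V ** herm V) $ i $ j"
      unfolding integral_bilinear_std_gaussian by (simp add: matrix_matrix_mult_def herm_def)
    finally show ?thesis .
  qed
  then show ?thesis by (simp add: vec_eq_iff)
qed

lemma noise_pseudo_cov_eq: "noise_pseudo_cov (V :: complex^'m^'i) = V ** transpose V"
proof -
  have "noise_pseudo_cov V $ i $ j = (V ** transpose V) $ i $ j" for i j
  proof -
    have "(\<lambda>n :: complex^'i. n $ i * n $ j) \<in> borel_measurable borel"
      by (intro borel_measurable_continuous_onI continuous_intros)
    then have "noise_pseudo_cov V $ i $ j = (\<integral>w. noise_map V w $ i * noise_map V w $ j \<partial>std.gaussian 0)"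
      by (simp add: noise_pseudo_cov_def integral_noise_law)
    also have "\<dots> = (\<integral>w. (\<Sum>a\<in>UNIV. \<Sum>b\<in>UNIV. (V $ i $ a * V $ j $ b) *
        complex_of_real (w $ a * w $ b)) \<partial>std.gaussian 0)"
      by (simp add: noise_map_def matrix_vector_mult_def cvec_def sum_product mult_ac)
    also have "\<dots> = (V ** transpose V) $ i $ j"
      unfolding integral_bilinear_std_gaussian by (simp add: matrix_matrix_mult_def transpose_def)
    finally show ?thesis .
  qed
  then show ?thesis by (simp add: vec_eq_iff)
qed

section \<open>Reduction to a real linear model\<close>

definition cmat :: "real^'j^'i \<Rightarrow> complex^'j^'i" where
  "cmat M = (\<chi> i j. complex_of_real (M $ i $ j))"

definition cnj_mat :: "complex^'j^'i \<Rightarrow> complex^'j^'i" where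
  "cnj_mat M = (\<chi> i j. cnj (M $ i $ j))"

lemma cmat_mult: "cmat (M ** N) = cmat M ** cmat N"
  by (simp add: cmat_def matrix_matrix_mult_def vec_eq_iff)

lemma cmat_add: "cmat (M + N) = cmat M + cmat N"
  by (simp add: cmat_def vec_eq_iff)

lemma cmat_mat_1: "cmat (mat 1) = mat 1"
  by (simp add: cmat_def mat_def vec_eq_iff)

lemma cmat_mult_cvec: "cmat M *v cvec x = cvec (M *v x)"
  by (simp add: cmat_def cvec_def matrix_vector_mult_def vec_eq_iff)

lemma cvec_add: "cvec (x + y) = cvec x + cvec y"
  by (simp add: cvec_def vec_eq_iff)

lemma cvec_diff: "cvec (x - y) = cvec x - cvec y"
  by (simp add: cvec_def vec_eq_iff)

lemma herm_cmat: "herm (cmat M) = cmat (transpose M)"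
  by (simp add: herm_def cmat_def transpose_def vec_eq_iff)

lemma herm_herm [simp]: "herm (herm M) = M"
  by (simp add: herm_def vec_eq_iff)

lemma herm_mult: "herm (M ** N) = herm N ** herm M"
  by (simp add: herm_def matrix_matrix_mult_def vec_eq_iff mult.commute)

lemma herm_transpose: "herm (transpose M) = cnj_mat M"
  by (simp add: herm_def transpose_def cnj_mat_def vec_eq_iff)

lemma cnj_mat_mult: "cnj_mat (M ** N) = cnj_mat M ** cnj_mat N"
  by (simp add: cnj_mat_def matrix_matrix_mult_def vec_eq_iff)

lemma cnj_mat_cnj_mat [simp]: "cnj_mat (cnj_mat M) = M"
  by (simp add: cnj_mat_def vec_eq_iff)

text \<open>For square matrices a one-sided inverse is two-sided and unique, so the choice made by
  \<open>matrix_inv\<close> must be \<open>B\<close>.\<close>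

lemma matrix_inv_eqI:
  fixes A B :: "'a::field^'n^'n"
  assumes "A ** B = mat 1"
  shows "matrix_inv A = B"
proof -
  have "B ** A = mat 1"
    using assms by (simp add: matrix_left_right_inverse)
  then have "invertible A"
    using assms by (auto simp: invertible_def)
  then have "matrix_inv A ** A = mat 1"
    unfolding invertible_def matrix_inv_def by (rule someI2_ex) simp
  then have "matrix_inv A ** (A ** B) = B"
    by (simp add: matrix_mul_assoc)
  then show ?thesis by (simp add: assms)
qed

lemma matrix_inv_mult:
  assumes "invertible A"
  shows "A ** matrix_inv A = mat 1" "matrix_inv A ** A = mat 1"
  using someI_ex[OF assms[unfolded invertible_def]] by (simp_all add: matrix_inv_def)

lemma herm_matrix_inv:
  assumes "herm R = R" "invertible R"
  shows "herm (matrix_inv R) = matrix_inv R"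
proof -
  have "herm (matrix_inv R ** R) = mat 1"
    by (simp add: matrix_inv_mult(2)[OF assms(2)]) (simp add: herm_def mat_def vec_eq_iff)
  then show ?thesis
    using matrix_inv_eqI[of R "herm (matrix_inv R)"] by (simp add: herm_mult assms(1))
qed

text \<open>
  The condition on the pseudo-covariance turns into \<open>V cnj W = A\<close> for \<open>W = V\<^sup>H R\<^sup>-\<^sup>1 A\<close>, while
  \<open>V W = A\<close> holds by definition of \<open>R\<close>. As \<open>V\<close> is injective on real vectors, \<open>Im W = 0\<close>.
\<close>

lemma whitened_matrix_real:
  fixes V :: "complex^'m^'i" and A :: "complex^'k^'i"
  assumes inj: "inj (noise_map V)"
    and inv: "invertible (V ** herm V)"
    and pseudo: "herm A ** matrix_inv (V ** herm V) ** (V ** transpose V) = transpose A"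
  obtains W where "V ** cmat W = A" "herm V ** matrix_inv (V ** herm V) ** A = cmat W"
proof -
  define R where "R = V ** herm V"
  define U where "U = herm V ** matrix_inv R ** A"
  have hR: "herm (matrix_inv R) = matrix_inv R"
    using inv by (intro herm_matrix_inv) (simp_all add: R_def herm_mult)
  have VU: "V ** U = A"
    using matrix_inv_mult(1)[OF inv] by (simp add: U_def R_def matrix_mul_assoc)
  \<comment> \<open>The Hermitian transpose of \<open>pseudo\<close>, with the inverse of
    \<open>R\<close> Hermitian, reads \<open>cnj_mat A = cnj_mat V ** U\<close>; entrywise
    conjugation then gives a second factorisation of \<open>A\<close> through
    \<open>V\<close>.\<close>
  have "cnj_mat A = herm (herm A ** matrix_inv R ** (V ** transpose V))"
    unfolding R_def pseudo by (simp add: herm_transpose)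
  also have "\<dots> = cnj_mat V ** U"
    by (simp add: U_def herm_mult herm_transpose hR matrix_mul_assoc)
  finally have "V ** cnj_mat U = A"
    by (metis cnj_mat_cnj_mat cnj_mat_mult)
  then have "V ** U = V ** cnj_mat U" by (simp add: VU)
  then have eq: "(\<Sum>a\<in>UNIV. V $ i $ a * U $ a $ j) = (\<Sum>a\<in>UNIV. V $ i $ a * cnj (U $ a $ j))" for i j
    by (simp add: matrix_matrix_mult_def cnj_mat_def vec_eq_iff)
  have "Im (U $ a $ j) = 0" for a j
  proof -
    let ?v = "\<chi> a. Im (U $ a $ j)"
    \<comment> \<open>Since \<open>U - cnj U\<close> is \<open>2 * \<i>\<close> times the imaginary
      part, the imaginary part of each column of \<open>U\<close> is a real vector that
      \<open>V\<close> sends to 0.\<close>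
    have "2 * \<i> * (noise_map V ?v $ i) = 0" for i
    proof -
      have "2 * \<i> * (noise_map V ?v $ i) = (\<Sum>a\<in>UNIV. V $ i $ a * (U $ a $ j - cnj (U $ a $ j)))"
        by (simp add: noise_map_def matrix_vector_mult_def cvec_def sum_distrib_left complex_diff_cnj mult_ac)
      also have "\<dots> = 0"
        using eq[of i j] by (simp add: right_diff_distrib sum_subtractf)
      finally show ?thesis .
    qed
    then have "noise_map V ?v = noise_map V 0"
      using linear_0[OF linear_noise_map[of V]] by (simp add: vec_eq_iff)
    then have "?v = 0"
      using inj by (rule injD[rotated])
    then show ?thesis by (simp add: vec_eq_iff)
  qed
  then have U: "cmat (\<chi> a j. Re (U $ a $ j)) = U"
    by (simp add: cmat_def vec_eq_iff complex_eq_iff)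
  show ?thesis
  proof (rule that)
    show "V ** cmat (\<chi> a j. Re (U $ a $ j)) = A"
      by (simp add: U VU)
    show "herm V ** matrix_inv (V ** herm V) ** A = cmat (\<chi> a j. Re (U $ a $ j))"
      unfolding U by (simp add: U_def R_def)
  qed
qed

section \<open>The posterior precision matrix\<close>

definition real_diag :: "real^'i \<Rightarrow> real^'i^'i" where
  "real_diag d = (\<chi> i j. if i = j then d $ i else 0)"

text \<open>Symmetry, coercivity and the completion of the square are all read off from this
  bilinear form.\<close>

lemma inner_precision:
  fixes W :: "real^'i^'m"
  shows "x \<bullet> ((transpose W ** W + real_diag d) *v y) = (W *v x) \<bullet> (W *v y) + (\<Sum>i\<in>UNIV. d $ i * x $ i * y $ i)"
proof -
  have "x \<bullet> ((transpose W ** W) *v y) = (W *v x) \<bullet> (W *v y)"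
    by (metis dot_lmul_matrix inner_commute matrix_vector_mul_assoc transpose_matrix_vector)
  moreover have "(real_diag d *v y) $ i = d $ i * y $ i" for i
    by (simp add: real_diag_def matrix_vector_mult_def if_distrib[of "\<lambda>u. u * _"] cong: if_cong)
  then have "x \<bullet> (real_diag d *v y) = (\<Sum>i\<in>UNIV. d $ i * x $ i * y $ i)"
    by (simp add: inner_vec_def mult_ac)
  ultimately show ?thesis
    by (simp add: matrix_vector_mult_add_rdistrib inner_add_right)
qed

text \<open>The part from \<open>W\<close> is positive semidefinite, so the smallest diagonal entry
  of \<open>d\<close> serves as coercivity constant.\<close>

lemma gaussian_weight_precision:
  fixes W :: "real^'i^'m"
  assumes "\<And>i. 0 < d $ i"
  shows "gaussian_weight (\<lambda>x. (transpose W ** W + real_diag d) *v x) (Min (range (($) d)))"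
proof (rule gaussian_weight.intro)
  show "linear (\<lambda>x. (transpose W ** W + real_diag d) *v x)"
    by (rule matrix_vector_mul_linear)
  fix x y :: "real^'i"
  show "x \<bullet> ((transpose W ** W + real_diag d) *v y) = ((transpose W ** W + real_diag d) *v x) \<bullet> y"
    by (subst (2) inner_commute) (simp add: inner_precision inner_commute mult_ac)
  have "Min (range (($) d)) * (x \<bullet> x) = (\<Sum>i\<in>UNIV. Min (range (($) d)) * (x $ i * x $ i))"
    by (simp add: inner_vec_def sum_distrib_left)
  also have "\<dots> \<le> (\<Sum>i\<in>UNIV. d $ i * (x $ i * x $ i))"
    by (intro sum_mono mult_right_mono) auto
  finally show "Min (range (($) d)) * (x \<bullet> x) \<le> x \<bullet> ((transpose W ** W + real_diag d) *v x)"
    using inner_ge_zero[of "W *v x"] unfolding inner_precision mult.assoc by linarith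
  show "0 < Min (range (($) d))"
    using assms by (subst Min_gr_iff) auto
qed

lemma invertible_precision:
  fixes W :: "real^'i^'m"
  assumes "\<And>i. 0 < d $ i"
  shows "invertible (transpose W ** W + real_diag d)"
proof -
  let ?S = "transpose W ** W + real_diag d"
  interpret gaussian_weight "\<lambda>x. ?S *v x" "Min (range (($) d))"
    by (rule gaussian_weight_precision[OF assms])
  have "x = 0" if "?S *v x = 0" for x
  proof -
    have "Min (range (($) d)) * (x \<bullet> x) \<le> 0"
      using coercive(1)[of x] that by simp
    then have "\<not> 0 < x \<bullet> x"
      using mult_pos_pos[OF coercive(2), of "x \<bullet> x"] by linarith
    then show ?thesis by simp
  qed
  then show ?thesis
    by (simp add: invertible_left_inverse matrix_left_invertible_ker)
qed

text \<open>The assumption is the normal equation for \<open>\<mu>\<close>: it makes the terms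
  linear in \<open>h\<close> agree, and what remains is free of \<open>h\<close>.\<close>

lemma complete_square:
  fixes W :: "real^'i^'m"
  assumes "(transpose W ** W + real_diag d) *v \<mu> = transpose W *v z"
  shows "(z - W *v h) \<bullet> (z - W *v h) + (\<Sum>i\<in>UNIV. d $ i * h $ i * h $ i) =
    (h - \<mu>) \<bullet> ((transpose W ** W + real_diag d) *v (h - \<mu>)) + (z \<bullet> z - \<mu> \<bullet> (transpose W *v z))"
proof -
  let ?S = "transpose W ** W + real_diag d"
  have Wz: "x \<bullet> (transpose W *v z) = z \<bullet> (W *v x)" for x
    by (metis dot_lmul_matrix inner_commute transpose_matrix_vector)
  have "\<mu> \<bullet> (?S *v h) = h \<bullet> (?S *v \<mu>)"
    by (simp add: inner_precision inner_commute mult_ac)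
  then have "(h - \<mu>) \<bullet> (?S *v (h - \<mu>)) = h \<bullet> (?S *v h) - 2 * (z \<bullet> (W *v h)) + \<mu> \<bullet> (transpose W *v z)"
    by (simp add: assms Wz matrix_vector_mult_diff_distrib inner_diff_left inner_diff_right
        del: transpose_matrix_vector)
  then show ?thesis
    by (simp add: inner_precision inner_diff_left inner_diff_right inner_commute)
qed

section \<open>The EM objective\<close>

lemma prior_pdf_eq_exp:
  fixes \<gamma> :: "real^'k" and h :: "real^('l::finite \<times> 'k)"
  assumes "\<And>k. 0 < \<gamma> $ k"
  shows "prior_pdf \<gamma> h = exp (\<Sum>p\<in>UNIV. - (ln (2 * pi) + ln (\<gamma> $ snd p)) / 2 - (h $ p)\<^sup>2 / (2 * \<gamma> $ snd p))"
proof -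
  have factor: "1 / sqrt (2 * pi * \<gamma> $ k) * exp (- \<bar>u\<bar>\<^sup>2 / (2 * \<gamma> $ k)) =
      exp (- (ln (2 * pi) + ln (\<gamma> $ k)) / 2 - u\<^sup>2 / (2 * \<gamma> $ k))" for k u
  proof -
    have "sqrt (2 * pi * \<gamma> $ k) = exp (ln (2 * pi * \<gamma> $ k) / 2)"
      using assms[of k] by (simp add: ln_sqrt[symmetric])
    also have "ln (2 * pi * \<gamma> $ k) = ln (2 * pi) + ln (\<gamma> $ k)"
      using assms[of k] by (simp add: ln_mult)
    finally have "1 / sqrt (2 * pi * \<gamma> $ k) = exp (- (ln (2 * pi) + ln (\<gamma> $ k)) / 2)"
      by (simp only: minus_divide_left[symmetric] exp_minus inverse_eq_divide)
    then show ?thesis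
      by (simp only: mult_exp_exp power2_abs minus_divide_left[symmetric] diff_conv_add_uminus)
  qed
  show ?thesis
    unfolding prior_pdf_def factor
    by (simp add: exp_sum prod.cartesian_product case_prod_beta)
qed

text \<open>This is \<open>ln u \<le> u - 1\<close> at \<open>u = r / x\<close>, where equality
  forces \<open>u = 1\<close>.\<close>

lemma ln_add_inverse_ge:
  fixes x r :: real
  assumes "0 < x" "0 < r"
  shows "ln r + 1 \<le> ln x + r / x" "ln x + r / x = ln r + 1 \<Longrightarrow> x = r"
proof -
  have eq: "ln (r / x) = ln r - ln x"
    using assms by (simp add: ln_div)
  show "ln r + 1 \<le> ln x + r / x"
    using ln_le_minus_one[of "r / x"] assms by (simp add: eq)
  show "x = r" if "ln x + r / x = ln r + 1"
    using ln_eq_minus_one[of "r / x"] that assms by (simp add: eq)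
qed

text \<open>The variables separate, and each summand is smallest exactly at \<open>r $ k\<close>.
  Positivity of \<open>r\<close> makes this point feasible.\<close>

lemma is_arg_max_sum_ln_inverse:
  fixes r :: "real^'k" and f :: "real^'k \<Rightarrow> real"
  assumes r: "\<And>k. 0 < r $ k" and "0 < a"
    and f: "\<And>\<gamma>. (\<And>k. 0 < \<gamma> $ k) \<Longrightarrow> f \<gamma> = C - a * (\<Sum>k\<in>UNIV. ln (\<gamma> $ k) + r $ k / \<gamma> $ k)"
  shows "is_arg_max f (\<lambda>\<gamma>. \<forall>k. 0 < \<gamma> $ k) \<gamma> \<longleftrightarrow> \<gamma> = r"
proof -
  have fr: "f r = C - a * (\<Sum>k\<in>UNIV. ln (r $ k) + 1)"
    using r by (simp add: f less_imp_neq[THEN not_sym])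
  have le: "f \<gamma> \<le> f r" if "\<forall>k. 0 < \<gamma> $ k" for \<gamma>
    using that r \<open>0 < a\<close> ln_add_inverse_ge(1) by (auto simp: fr f intro!: sum_mono)
  have uniq: "\<gamma> = r" if pos: "\<forall>k. 0 < \<gamma> $ k" and "f r \<le> f \<gamma>" for \<gamma>
  proof -
    have "(\<Sum>k\<in>UNIV. ln (\<gamma> $ k) + r $ k / \<gamma> $ k) \<le> (\<Sum>k\<in>UNIV. ln (r $ k) + 1)"
      using that \<open>0 < a\<close> by (simp add: fr f)
    \<comment> \<open>One differing coordinate makes its summand strictly larger, which contradicts
      the inequality between the sums.\<close>
    moreover have "(\<Sum>k\<in>UNIV. ln (r $ k) + 1) < (\<Sum>k\<in>UNIV. ln (\<gamma> $ k) + r $ k / \<gamma> $ k)" if "\<gamma> $ j \<noteq> r $ j" for j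
    proof (rule sum_strict_mono_ex1)
      show "\<forall>k\<in>UNIV. ln (r $ k) + 1 \<le> ln (\<gamma> $ k) + r $ k / \<gamma> $ k"
        using pos r ln_add_inverse_ge(1) by blast
      show "\<exists>k\<in>UNIV. ln (r $ k) + 1 < ln (\<gamma> $ k) + r $ k / \<gamma> $ k"
        using that pos r ln_add_inverse_ge[of "\<gamma> $ j" "r $ j"] by (intro bexI[of _ j]) (auto simp: less_le)
    qed simp
    ultimately show ?thesis
      by (auto simp: vec_eq_iff not_less[symmetric])
  qed
  show ?thesis
    using le uniq r unfolding is_arg_max_def by (metis not_less)
qed

lemma kronecker_inv_cdiag:
  fixes \<gamma> :: "real^'k"
  assumes "\<And>k. 0 < \<gamma> $ k"
  shows "kronecker (mat 1 :: complex^'l^'l) (matrix_inv (cdiag \<gamma>)) =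
    cmat (real_diag (\<chi> p :: 'l::finite \<times> 'k. 1 / \<gamma> $ snd p))"
proof -
  have "\<gamma> $ k \<noteq> 0" for k
    using assms[of k] by simp
  then have "cdiag \<gamma> ** cdiag (\<chi> k. 1 / \<gamma> $ k) = mat 1"
    by (simp add: cdiag_def matrix_matrix_mult_def mat_def vec_eq_iff if_distrib[of "\<lambda>u. u * _"] cong: if_cong)
  then have "matrix_inv (cdiag \<gamma>) = cdiag (\<chi> k. 1 / \<gamma> $ k)"
    by (rule matrix_inv_eqI)
  then show ?thesis
    by (auto simp: kronecker_def cmat_def real_diag_def cdiag_def mat_def vec_eq_iff prod_eq_iff)
qed

text \<open>The posterior is Gaussian with precision \<open>S\<close> and mean \<open>\<mu>\<close>,
  so \<open>M p\<close> is the posterior mean of \<open>(h $ p)\<^sup>2\<close>. Only the log-prior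
  depends on the new hyperparameters, and it is affine in these squares.\<close>

lemma em_objective_arg_max:
  fixes B :: "'l::finite \<Rightarrow> complex^'k::finite^'n::finite"
    and V :: "complex^'m^('l \<times> 'n)" and W :: "real^('l \<times> 'k)^'m" and z :: "real^'m"
    and \<gamma>_prev :: "real^'k"
  assumes lik: "\<And>h. likelihood B V y h = std_normal_pdf (z - W *v h)"
    and pos: "\<And>k. 0 < \<gamma>_prev $ k"
  defines "S \<equiv> transpose W ** W + real_diag (\<chi> p. 1 / \<gamma>_prev $ snd p)"
  defines "\<mu> \<equiv> matrix_inv S *v (transpose W *v z)"
  defines "M \<equiv> \<lambda>p. matrix_inv S $ p $ p + (\<mu> $ p)\<^sup>2"
  shows "is_arg_max (em_objective B V y \<gamma>_prev) (\<lambda>\<gamma>. \<forall>k. 0 < \<gamma> $ k) \<gamma> \<longleftrightarrow>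
    \<gamma> = (\<chi> k. (\<Sum>l\<in>UNIV. M (l, k)) / real CARD('l))"
proof -
  define d :: "real^('l \<times> 'k)" where "d = (\<chi> p. 1 / \<gamma>_prev $ snd p)"
  have d: "0 < d $ p" for p
    using pos by (simp add: d_def)
  have S: "S = transpose W ** W + real_diag d"
    by (simp add: S_def d_def)
  interpret gaussian_weight "\<lambda>x. S *v x" "Min (range (($) d))"
    unfolding S by (rule gaussian_weight_precision[OF d])
  have inv: "invertible S"
    unfolding S by (rule invertible_precision[OF d])
  have S_inv: "S *v (matrix_inv S *v x) = x" for x
    by (simp add: matrix_vector_mul_assoc matrix_inv_mult(1)[OF inv])
  have S_mu: "S *v \<mu> = transpose W *v z"
    by (simp add: \<mu>_def S_inv)
  define K where "K = (1 / sqrt (2 * pi)) ^ CARD('m)"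
  have K: "0 < K" by (simp add: K_def)
  \<comment> \<open>The logarithm of the normalising constant of the prior at
    \<open>\<gamma>_prev\<close>.\<close>
  define e where "e = (\<Sum>p\<in>(UNIV :: ('l \<times> 'k) set). - (ln (2 * pi) + ln (\<gamma>_prev $ snd p)) / 2)"
  have "joint_pdf B V \<gamma>_prev y h =
      (K * exp e * exp (- (z \<bullet> z - \<mu> \<bullet> (transpose W *v z)) / 2)) * weight (h - \<mu>)" for h
  proof -
    have "joint_pdf B V \<gamma>_prev y h = K * exp (- ((z - W *v h) \<bullet> (z - W *v h)) / 2) *
        exp (e - (\<Sum>p\<in>UNIV. d $ p * h $ p * h $ p) / 2)"
      by (simp add: joint_pdf_def lik std_normal_pdf_eq K_def prior_pdf_eq_exp[OF pos] e_def d_def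
          sum_subtractf sum_divide_distrib power2_eq_square mult_ac)
    also have "\<dots> = K * exp (e - ((z - W *v h) \<bullet> (z - W *v h) + (\<Sum>p\<in>UNIV. d $ p * h $ p * h $ p)) / 2)"
      by (simp add: exp_add[symmetric] add_divide_distrib)
    also have "(z - W *v h) \<bullet> (z - W *v h) + (\<Sum>p\<in>UNIV. d $ p * h $ p * h $ p) =
        (h - \<mu>) \<bullet> (S *v (h - \<mu>)) + (z \<bullet> z - \<mu> \<bullet> (transpose W *v z))"
      unfolding S by (rule complete_square) (simp add: S[symmetric] S_mu)
    finally show ?thesis
      by (simp add: weight_def exp_add[symmetric] add_divide_distrib diff_divide_distrib)
  qed
  then have posterior: "posterior B V \<gamma>_prev y = gaussian \<mu>"
    unfolding posterior_def by (rule density_eq_gaussian) (simp add: K)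
  \<comment> \<open>Column \<open>p\<close> of the inverse of \<open>S\<close>. Since
    \<open>S *v v p\<close> is a unit vector, pairing with it extracts coordinate \<open>p\<close>,
    and \<open>v p \<bullet> (S *v v p)\<close> is the posterior variance.\<close>
  define v where "v p = matrix_inv S *v axis p 1" for p
  have S_v: "S *v v p = axis p 1" for p
    by (simp add: v_def S_inv)
  have v_diag: "v p $ p = matrix_inv S $ p $ p" for p
    by (simp add: v_def matrix_vector_mul_component inner_axis row_def)
  have second: "(\<integral>h. (h $ p)\<^sup>2 \<partial>gaussian \<mu>) = M p" for p
    using integral_gaussian_power2[of \<mu> "v p"] by (simp add: S_v inner_axis v_diag M_def)
  have int_sq: "integrable (gaussian \<mu>) (\<lambda>h. (h $ p)\<^sup>2)" for p
  proof (rule integrable_gaussian_quadratic)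
    show "(\<lambda>h :: real^('l \<times> 'k). (h $ p)\<^sup>2) \<in> borel_measurable borel"
      by (intro borel_measurable_continuous_onI continuous_intros)
    show "\<bar>(h $ p)\<^sup>2\<bar> \<le> 0 + 1 * (h \<bullet> h)" for h :: "real^('l \<times> 'k)"
      using component_le_norm_cart[of h p] by (simp add: dot_square_norm abs_le_square_iff[symmetric])
  qed simp
  \<comment> \<open>The log-likelihood is quadratic in \<open>h\<close>; its integrability allows
    the objective to be split into a term free of the new hyperparameters and the expected
    log-prior.\<close>
  have int_lik: "integrable (gaussian \<mu>) (\<lambda>h. ln (likelihood B V y h))"
  proof -
    have W_linear: "bounded_linear (\<lambda>h. W *v h)"
      by (simp add: linear_conv_bounded_linear[symmetric])
    then obtain b where b: "0 \<le> b" "\<And>h. norm (W *v h) \<le> norm h * b"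
      using bounded_linear.nonneg_bounded by blast
    have ln_lik: "ln (likelihood B V y h) = ln K - (z - W *v h) \<bullet> (z - W *v h) / 2" for h
      using K by (simp add: lik std_normal_pdf_eq K_def[symmetric] ln_mult)
    show ?thesis
      unfolding ln_lik
    proof (rule integrable_gaussian_quadratic)
      show "(\<lambda>h. ln K - (z - W *v h) \<bullet> (z - W *v h) / 2) \<in> borel_measurable borel"
        by (intro borel_measurable_continuous_onI continuous_intros linear_continuous_on[OF W_linear]) simp
      show "\<bar>ln K - (z - W *v h) \<bullet> (z - W *v h) / 2\<bar> \<le> (\<bar>ln K\<bar> + z \<bullet> z) + b\<^sup>2 * (h \<bullet> h)" for h
      proof -
        have "(norm (W *v h))\<^sup>2 \<le> (norm h * b)\<^sup>2"
          by (rule power_mono[OF b(2)]) simp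
        then have "(W *v h) \<bullet> (W *v h) \<le> b\<^sup>2 * (h \<bullet> h)"
          by (simp add: dot_square_norm power_mult_distrib mult.commute)
        moreover have "(z - W *v h) \<bullet> (z - W *v h) \<le> 2 * (z \<bullet> z) + 2 * ((W *v h) \<bullet> (W *v h))"
          using inner_ge_zero[of "z + W *v h"] by (simp add: algebra_simps inner_commute)
        moreover have "0 \<le> (z - W *v h) \<bullet> (z - W *v h)" by simp
        ultimately show ?thesis by linarith
      qed
    qed simp
  qed
  have objective: "em_objective B V y \<gamma>_prev \<gamma> = (\<integral>h. ln (likelihood B V y h) \<partial>gaussian \<mu>) +
      (\<Sum>p\<in>UNIV. - (ln (2 * pi) + ln (\<gamma> $ snd p)) / 2 - M p / (2 * \<gamma> $ snd p))"
    if "\<And>k. 0 < \<gamma> $ k" for \<gamma>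
  proof -
    let ?q = "\<lambda>h p. - (ln (2 * pi) + ln (\<gamma> $ snd p)) / 2 - (h $ p)\<^sup>2 / (2 * \<gamma> $ snd p)"
    have const: "integrable (gaussian \<mu>) (\<lambda>_. k :: real)" for k
      using integrable_gaussian_quadratic[of "\<lambda>_. k" "\<bar>k\<bar>" 0] by simp
    have int_q: "integrable (gaussian \<mu>) (\<lambda>h. ?q h p)" for p
      by (intro Bochner_Integration.integrable_diff const integrable_divide int_sq)
    have val_q: "(\<integral>h. ?q h p \<partial>gaussian \<mu>) =
        - (ln (2 * pi) + ln (\<gamma> $ snd p)) / 2 - M p / (2 * \<gamma> $ snd p)" for p
      by (subst Bochner_Integration.integral_diff, intro const, intro integrable_divide int_sq,
          unfold integral_gaussian_const integral_divide_zero second) (rule refl)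
    have "ln (joint_pdf B V \<gamma> y h) = ln (likelihood B V y h) + (\<Sum>p\<in>UNIV. ?q h p)" for h
      using std_normal_pdf_pos[of "z - W *v h"]
      by (simp add: joint_pdf_def prior_pdf_eq_exp[OF that] lik ln_mult)
    then have "em_objective B V y \<gamma>_prev \<gamma> =
        (\<integral>h. ln (likelihood B V y h) + (\<Sum>p\<in>UNIV. ?q h p) \<partial>gaussian \<mu>)"
      by (simp add: em_objective_def posterior)
    also have "\<dots> = (\<integral>h. ln (likelihood B V y h) \<partial>gaussian \<mu>) + (\<integral>h. (\<Sum>p\<in>UNIV. ?q h p) \<partial>gaussian \<mu>)"
      by (intro Bochner_Integration.integral_add int_lik Bochner_Integration.integrable_sum int_q)
    also have "(\<integral>h. (\<Sum>p\<in>UNIV. ?q h p) \<partial>gaussian \<mu>) = (\<Sum>p\<in>UNIV. \<integral>h. ?q h p \<partial>gaussian \<mu>)"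
      by (intro Bochner_Integration.integral_sum int_q)
    finally show ?thesis
      by (simp only: val_q)
  qed
  let ?r = "\<chi> k. (\<Sum>l\<in>UNIV. M (l, k)) / real CARD('l)"
  have regroup: "(\<Sum>p\<in>UNIV. f p) = (\<Sum>k\<in>UNIV. \<Sum>l\<in>UNIV. f (l, k))" for f :: "'l \<times> 'k \<Rightarrow> real"
    by (subst sum.swap) (simp add: sum.cartesian_product)
  \<comment> \<open>Coercivity makes the diagonal of the inverse of \<open>S\<close> positive, so
    the candidate lies in the open positive orthant.\<close>
  have M_pos: "0 < M p" for p
  proof -
    have "v p \<noteq> 0"
      by (metis S_v axis_eq_0_iff matrix_vector_mult_0_right zero_neq_one)
    then have "0 < v p \<bullet> (S *v v p)"
      using coercive mult_pos_pos[OF coercive(2), of "v p \<bullet> v p"]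
      by (meson inner_gt_zero_iff less_le_trans)
    then have "0 < v p $ p"
      by (simp add: S_v inner_axis)
    then show ?thesis
      by (simp add: v_diag M_def add_pos_nonneg)
  qed
  show ?thesis
  proof (rule is_arg_max_sum_ln_inverse)
    show "0 < ?r $ k" for k
      using M_pos by (simp add: sum_pos)
    show "0 < real CARD('l) / 2" by simp
    fix \<gamma> :: "real^'k"
    assume \<gamma>: "\<And>k. 0 < \<gamma> $ k"
    \<comment> \<open>All entries of group \<open>k\<close> share \<open>\<gamma> $ k\<close>, so
      their second moments enter only through the sum over \<open>l\<close>; factoring out half the
      number of frames turns it into the average.\<close>
    have summand: "(\<Sum>l\<in>UNIV. - (ln (2 * pi) + ln (\<gamma> $ k)) / 2 - M (l, k) / (2 * \<gamma> $ k)) =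
        - (real CARD('l) / 2) * ln (2 * pi) - real CARD('l) / 2 * (ln (\<gamma> $ k) + ?r $ k / \<gamma> $ k)" for k
    proof -
      have "(\<Sum>l\<in>UNIV. - (ln (2 * pi) + ln (\<gamma> $ k)) / 2 - M (l, k) / (2 * \<gamma> $ k)) =
          - real CARD('l) * ((ln (2 * pi) + ln (\<gamma> $ k)) / 2) - (\<Sum>l\<in>UNIV. M (l, k)) / (2 * \<gamma> $ k)"
        by (simp add: sum_subtractf sum_divide_distrib[symmetric] right_diff_distrib distrib_left)
      also have "\<dots> = - (real CARD('l) / 2) * ln (2 * pi) - real CARD('l) / 2 * (ln (\<gamma> $ k) + ?r $ k / \<gamma> $ k)"
        using \<gamma>[of k] by (simp add: field_simps)
      finally show ?thesis .
    qed
    show "em_objective B V y \<gamma>_prev \<gamma> =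
        ((\<integral>h. ln (likelihood B V y h) \<partial>gaussian \<mu>) + (\<Sum>k\<in>(UNIV :: 'k set). - (real CARD('l) / 2) * ln (2 * pi))) -
          real CARD('l) / 2 * (\<Sum>k\<in>UNIV. ln (\<gamma> $ k) + ?r $ k / \<gamma> $ k)"
      unfolding objective[OF \<gamma>] regroup snd_conv summand
      by (simp add: sum_subtractf sum_distrib_left)
  qed
qed

text \<open>The assumption \<open>model\<close> places \<open>y\<close> in the support of its law,
  so the likelihood is positive and the posterior is well normalised. The equivalence for
  \<open>is_arg_max\<close> makes \<open>\<gamma>_new\<close> the unique maximiser over positive
  vectors, and the equation in complex numbers includes that its right-hand side is real.\<close>

theorem theorem1:
  fixes B :: "'l::finite \<Rightarrow> complex^'k::finite^'n::finite"
    and V :: "complex^'m::finite^('l \<times> 'n)"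
    and R :: "complex^('l \<times> 'n)^('l \<times> 'n)"
    and y :: "complex^('l \<times> 'n)"
    and h0 :: "real^('l \<times> 'k)" and w0 :: "real^'m"
    and \<gamma>_prev :: "real^'k"
  assumes noise: "inj (noise_map V)"
    and covariance: "R = noise_cov V" "invertible R"
    and pseudo_covariance:
      "herm (blkdiag B) ** matrix_inv R ** noise_pseudo_cov V = transpose (blkdiag B)"
    and model: "y = blkdiag B *v cvec h0 + noise_map V w0"
    and pos: "\<forall>k. 0 < \<gamma>_prev $ k"
  shows "\<exists>\<gamma>_new :: real^'k.
    (\<forall>k. complex_of_real (\<gamma>_new $ k) =
       1 / of_nat CARD('l) * (\<Sum>l\<in>UNIV. Sigma_g B R \<gamma>_prev $ (l, k) $ (l, k)) +
       1 / of_nat CARD('l) * (\<Sum>l\<in>UNIV. complex_of_real ((cmod (mu_g B R \<gamma>_prev y $ (l, k)))\<^sup>2))) \<and>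
    (\<forall>\<gamma>. is_arg_max (em_objective B V y \<gamma>_prev) (\<lambda>\<gamma>. \<forall>k. 0 < \<gamma> $ k) \<gamma> \<longleftrightarrow> \<gamma> = \<gamma>_new)"
proof -
  have R: "R = V ** herm V"
    by (simp add: covariance(1) noise_cov_eq)
  have \<gamma>_pos: "0 < \<gamma>_prev $ k" for k
    using pos by simp
  obtain W where W: "V ** cmat W = blkdiag B" "herm V ** matrix_inv R ** blkdiag B = cmat W"
    using whitened_matrix_real[OF noise, of "blkdiag B"] covariance(2) pseudo_covariance
    unfolding R noise_pseudo_cov_eq by blast
  \<comment> \<open>The whitened observation: \<open>y = V *v cvec z\<close>, with white real noise
    \<open>w0\<close> in place of the original noise.\<close>
  define z where "z = W *v h0 + w0"
  define S where "S = transpose W ** W + real_diag (\<chi> p :: 'l \<times> 'k. 1 / \<gamma>_prev $ snd p)"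
  define \<mu> where "\<mu> = matrix_inv S *v (transpose W *v z)"
  have B_cvec: "blkdiag B *v cvec h = V *v cvec (W *v h)" for h
    by (simp add: W(1)[symmetric] matrix_vector_mul_assoc[symmetric] cmat_mult_cvec)
  have y: "y = V *v cvec z"
    by (simp add: model B_cvec z_def cvec_add noise_map_def matrix_vector_right_distrib)
  have lik: "likelihood B V y h = std_normal_pdf (z - W *v h)" for h
  proof -
    have "y - blkdiag B *v cvec h = noise_map V (z - W *v h)"
      by (simp add: y B_cvec noise_map_def cvec_diff matrix_vector_mult_diff_distrib)
    then show ?thesis
      by (simp add: likelihood_def noise_pdf_def the_inv_f_f[OF noise])
  qed
  have "herm R = R"
    by (simp add: R herm_mult)
  \<comment> \<open>The Hermitian transpose of the second equation in \<open>W\<close>. It makes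
    both the precision matrix and the mean real.\<close>
  then have BR: "herm (blkdiag B) ** matrix_inv R ** V = cmat (transpose W)"
    using arg_cong[OF W(2), of herm] herm_matrix_inv[OF _ covariance(2)]
    by (simp add: herm_mult herm_cmat matrix_mul_assoc)
  have inv: "invertible S"
    unfolding S_def by (rule invertible_precision) (simp add: \<gamma>_pos)
  have "herm (blkdiag B) ** matrix_inv R ** blkdiag B = herm (blkdiag B) ** matrix_inv R ** V ** cmat W"
    by (simp add: W(1) matrix_mul_assoc[symmetric])
  then have "herm (blkdiag B) ** matrix_inv R ** blkdiag B = cmat (transpose W ** W)"
    by (simp only: BR cmat_mult)
  then have "herm (blkdiag B) ** matrix_inv R ** blkdiag B + kronecker (mat 1) (matrix_inv (cdiag \<gamma>_prev)) = cmat S"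
    by (simp add: S_def cmat_add kronecker_inv_cdiag[OF \<gamma>_pos])
  moreover have "matrix_inv (cmat S) = cmat (matrix_inv S)"
    by (rule matrix_inv_eqI) (simp add: cmat_mult[symmetric] matrix_inv_mult(1)[OF inv] cmat_mat_1)
  ultimately have Sigma: "Sigma_g B R \<gamma>_prev = cmat (matrix_inv S)"
    by (simp add: Sigma_g_def)
  have "mu_g B R \<gamma>_prev y = cmat (matrix_inv S) *v ((herm (blkdiag B) ** matrix_inv R ** V) *v cvec z)"
    by (simp add: mu_g_def Sigma y matrix_vector_mul_assoc matrix_mul_assoc)
  then have mu: "mu_g B R \<gamma>_prev y = cvec \<mu>"
    by (simp add: BR cmat_mult_cvec \<mu>_def)
  let ?r = "\<chi> k. (\<Sum>l\<in>UNIV. matrix_inv S $ (l, k) $ (l, k) + (\<mu> $ (l, k))\<^sup>2) / real CARD('l)"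
  show ?thesis
  proof (intro exI conjI allI)
    show "complex_of_real (?r $ k) =
       1 / of_nat CARD('l) * (\<Sum>l\<in>UNIV. Sigma_g B R \<gamma>_prev $ (l, k) $ (l, k)) +
       1 / of_nat CARD('l) * (\<Sum>l\<in>UNIV. complex_of_real ((cmod (mu_g B R \<gamma>_prev y $ (l, k)))\<^sup>2))" for k
      by (simp add: Sigma mu cmat_def cvec_def sum.distrib add_divide_distrib)
    show "is_arg_max (em_objective B V y \<gamma>_prev) (\<lambda>\<gamma>. \<forall>k. 0 < \<gamma> $ k) \<gamma> \<longleftrightarrow> \<gamma> = ?r" for \<gamma>
      using em_objective_arg_max[OF lik \<gamma>_pos] unfolding S_def \<mu>_def .
  qed
qed

end
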